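(* For any integers $l,w\ge 1$ and $i\in\{1,2\}$, the reliability polynomials of hammock networks satisfy, for all $p\in[0,1]$, $$h_{l,w}^{(i)}(p)=1-h_{w,l}^{(2/i)}(1-p),$$ where $2/i$ denotes $2$ if $i=1$ and $1$ if $i=2$.
   Context: Lattice points and edges. For integers $l,w\ge 1$, let $\mathcal{V}_{l,w}=\{A_{x,y}=(x,y)\in\mathbb{Z}^2: 0\le x\le l,\ 0\le y\le w\}$. Let $V_{l,w}^{(1)}$ (resp. $V_{l,w}^{(2)}$) be the subset of points $A_{x,y}\in\mathcal{V}_{l,w}$ with $x+y$ even (resp. odd). Let $\mathcal{E}_{l,w}$ be the set of all (undirected) line segments $A_{x,y}A_{x',y'}$ with $A_{x,y},A_{x',y'}\in\mathcal{V}_{l,w}$ and $|x-x'|=|y-y'|=1$. The endpoints of such a segment have coordinate sums of the same parity; $E_{l,w}^{(1)}$ (resp. $E_{l,w}^{(2)}$) is the set of segments $A_{x,y}A_{x',y'}\in\mathcal{E}_{l,w}$ with $x+y$ even (resp. odd). Each of $E_{l,w}^{(1)}$, $E_{l,w}^{(2)}$ has $lw$ elements. X-paths. An X-path is a sequence of pairwise distinct lattice points $v_0,v_1,\ldots,v_k\in\mathbb{Z}^2$ with $v_j-v_{j-1}\in\{(1,1),(-1,1),(1,-1),(-1,-1)\}$ for $j=1,\ldots,k$; it is regarded as the set of the $k$ line segments $v_{j-1}v_j$. Hammock networks. For $i\in\{1,2\}$, the hammock network of kind $i$ and dimensions $(l,w)$ is the graph $H_{l,w}^{(i)}=(V_{l,w}^{(i)},E_{l,w}^{(i)})$,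 whose source nodes are the points $A_{0,y}\in V_{l,w}^{(i)}$ and whose terminus nodes are the points $A_{l,z}\in V_{l,w}^{(i)}$. Each edge is independently closed (operational) with probability $p$ and open with probability $1-p$. Reliability polynomial. A pathset in $H_{l,w}^{(i)}$ is a subset of $E_{l,w}^{(i)}$ that contains (all the segments of) an X-path connecting a source node with a terminus node; $\mathcal{P}_{l,w}^{(i)}$ denotes the set of all pathsets. The reliability polynomial of $H_{l,w}^{(i)}$ (the probability that the closed edges contain an X-path from a source node to a terminus node) is $$h_{l,w}^{(i)}(p)=\sum_{P\in\mathcal{P}_{l,w}^{(i)}}p^{|P|}(1-p)^{lw-|P|}.$$ *)

theory Defs
  imports Complex_Main "HOL-Library.Product_Plus"
begin

type_synonym point = "int \<times> int"

definition lattice_points :: "nat \<Rightarrow> nat \<Rightarrow> point set" where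
  "lattice_points l w = {(x, y). 0 \<le> x \<and> x \<le> int l \<and> 0 \<le> y \<and> y \<le> int w}"

text \<open>Kind 1 is the even sublattice, kind 2 the odd one; no point is of any other kind.\<close>

definition of_kind :: "nat \<Rightarrow> point \<Rightarrow> bool" where
  "of_kind i v \<longleftrightarrow> (i = 1 \<and> even (fst v + snd v)) \<or> (i = 2 \<and> odd (fst v + snd v))"

definition hammock_nodes :: "nat \<Rightarrow> nat \<Rightarrow> nat \<Rightarrow> point set" where
  "hammock_nodes i l w = {v \<in> lattice_points l w. of_kind i v}"

text \<open>An undirected line segment is represented by the set of its two endpoints.\<close>

definition lattice_edges :: "nat \<Rightarrow> nat \<Rightarrow> point set set" where
  "lattice_edges l w =
     {{u, v} | u v. u \<in> lattice_points l w \<and> v \<in> lattice_points l w \<and>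
                    \<bar>fst u - fst v\<bar> = 1 \<and> \<bar>snd u - snd v\<bar> = 1}"

text \<open>The two endpoints of a segment have the same kind, so it is immaterial that all of
  them are tested.\<close>

definition hammock_edges :: "nat \<Rightarrow> nat \<Rightarrow> nat \<Rightarrow> point set set" where
  "hammock_edges i l w = {e \<in> lattice_edges l w. \<forall>v\<in>e. of_kind i v}"

definition X_path :: "point list \<Rightarrow> bool" where
  "X_path vs \<longleftrightarrow> vs \<noteq> [] \<and> distinct vs \<and>
     (\<forall>j. Suc j < length vs \<longrightarrow>
        vs ! Suc j - vs ! j \<in> {(1, 1), (-1, 1), (1, -1), (-1, -1)})"

definition path_segments :: "point list \<Rightarrow> point set set" where
  "path_segments vs = {{vs ! j, vs ! Suc j} | j. Suc j < length vs}"

definition source_nodes :: "nat \<Rightarrow> nat \<Rightarrow> nat \<Rightarrow> point set" where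
  "source_nodes i l w = {v \<in> hammock_nodes i l w. fst v = 0}"

definition terminus_nodes :: "nat \<Rightarrow> nat \<Rightarrow> nat \<Rightarrow> point set" where
  "terminus_nodes i l w = {v \<in> hammock_nodes i l w. fst v = int l}"

definition pathsets :: "nat \<Rightarrow> nat \<Rightarrow> nat \<Rightarrow> point set set set" where
  "pathsets i l w =
     {P. P \<subseteq> hammock_edges i l w \<and>
         (\<exists>vs. X_path vs \<and> hd vs \<in> source_nodes i l w \<and> last vs \<in> terminus_nodes i l w \<and>
               path_segments vs \<subseteq> P)}"

text \<open>The natural-number subtraction in the exponent never truncates, since a hammock
  network of dimensions \<open>(l, w)\<close> has exactly \<open>l * w\<close> edges.\<close>

definition reliability :: "nat \<Rightarrow> nat \<Rightarrow> nat \<Rightarrow> real \<Rightarrow> real" where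
  "reliability i l w p = (\<Sum>P\<in>pathsets i l w. p ^ card P * (1 - p) ^ (l * w - card P))"

end

theory Submission
  imports Defs
begin

text \<open>
  Each unit cell of the \<open>l \<times> w\<close> rectangle has two diagonals, one of each kind, so the edges of
  the hammock network of kind \<open>i\<close> correspond to the cells, and so do the edges of the
  network of the other kind. A state of the network is thus a set \<open>S\<close> of cells:
  the cells of \<open>S\<close> carry their diagonal of kind \<open>i\<close>, and all other cells
  are given their diagonal of the other kind. Reflection in the main diagonal preserves the
  kind of a point and turns bottom-to-top paths of the \<open>l \<times> w\<close> rectangle into source-to-terminus
  paths of the \<open>w \<times> l\<close> rectangle. The theorem then says that in every state exactly one of the
  following holds: the diagonals of kind \<open>i\<close> join left to right, or those of the other kind join
  bottom to top. Complementing the state exchanges \<open>p\<close> and \<open>1 - p\<close>, and the weights of all states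
  add up to 1.

  At least one crossing exists (\<open>some_crossing\<close>). Colour a point of kind \<open>i\<close> by 1 if it can be
  reached from the left side and by 0 otherwise, and a point of the other kind by 1 if it can
  be reached from the bottom. Without crossings all four sides have prescribed colours. A signed sum
  over the cells of the product of the two colour differences along the diagonals telescopes to
  its boundary terms (\<open>checkerboard_sum\<close>), which these colours force to be nonzero. So some cell has
  two diagonals that each join points of different colours, although the diagonal carried by
  the cell preserves reachability.

  The two crossings exclude each other (\<open>crossings_exclusive\<close>). Given a bottom-to-top path, let
  the potential of a point of kind \<open>i\<close> be the number of times, counted with sign, that the
  path passes on its left through a neighbouring horizontal strip. The potential is 0
  on the left side and 1 on the right side, and it is constant along any diagonal of kind \<open>i\<close>
  that the path does not cross.
\<close>

section \<open>Unit cells and their diagonals\<close>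

text \<open>A unit cell is represented by its lower left corner.\<close>

definition cells :: "nat \<Rightarrow> nat \<Rightarrow> point set" where
  "cells l w = {0..<int l} \<times> {0..<int w}"

definition diagonal :: "nat \<Rightarrow> point \<Rightarrow> point set" where
  "diagonal i = (\<lambda>(x, y). if of_kind i (x, y) then {(x, y), (x + 1, y + 1)}
                                         else {(x + 1, y), (x, y + 1)})"

lemma finite_cells [simp]: "finite (cells l w)"
  by (simp add: cells_def)

lemma card_cells: "card (cells l w) = l * w"
  by (simp add: cells_def card_cartesian_product)

lemma swap_cells: "prod.swap ` cells l w = cells w l"
  by (auto simp: cells_def image_iff)

lemma other_kind:
  assumes "i \<in> {1, 2}"
  shows "of_kind (2 div i) v \<longleftrightarrow> \<not> of_kind i v"
  using assms by (auto simp: of_kind_def)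

lemma of_kind_swap: "of_kind i (y, x) \<longleftrightarrow> of_kind i (x, y)"
  by (auto simp: of_kind_def)

lemma of_kind_neighbour:
  assumes "i \<in> {1, 2}"
  shows "of_kind i (x + 1, y) \<longleftrightarrow> \<not> of_kind i (x, y)"
    and "of_kind i (x, y + 1) \<longleftrightarrow> \<not> of_kind i (x, y)"
  using assms by (auto simp: of_kind_def)

lemma inj_diagonal: "inj (diagonal i)"
  by (auto simp: inj_def diagonal_def doubleton_eq_iff split: if_splits)

lemma diagonal_cases:
  assumes "{u, v} = diagonal i (a, b)"
  obtains "\<bar>fst u - fst v\<bar> = 1" "\<bar>snd u - snd v\<bar> = 1"
    "min (fst u) (fst v) = a" "min (snd u) (snd v) = b"
  using assms by (auto simp: diagonal_def doubleton_eq_iff split: if_splits)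

lemma hammock_edges_eq_diagonals:
  assumes "i \<in> {1, 2}"
  shows "hammock_edges i l w = diagonal i ` cells l w"
proof
  show "diagonal i ` cells l w \<subseteq> hammock_edges i l w"
  proof
    fix e assume "e \<in> diagonal i ` cells l w"
    then obtain x y where xy: "0 \<le> x" "x < int l" "0 \<le> y" "y < int w" "e = diagonal i (x, y)"
      by (auto simp: cells_def)
    have edgeI: "{u, v} \<in> hammock_edges i l w"
      if "u \<in> lattice_points l w" "v \<in> lattice_points l w" "of_kind i u" "of_kind i v"
        "\<bar>fst u - fst v\<bar> = 1" "\<bar>snd u - snd v\<bar> = 1" for u v
      unfolding hammock_edges_def lattice_edges_def using that by blast
    have corners: "(x, y) \<in> lattice_points l w" "(x + 1, y + 1) \<in> lattice_points l w"
      "(x + 1, y) \<in> lattice_points l w" "(x, y + 1) \<in> lattice_points l w"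
      using xy by (simp_all add: lattice_points_def)
    show "e \<in> hammock_edges i l w"
    proof (cases "of_kind i (x, y)")
      case True
      then have "of_kind i (x + 1, y + 1)" using of_kind_neighbour[OF assms] by simp
      then have "{(x, y), (x + 1, y + 1)} \<in> hammock_edges i l w"
        using corners True by (intro edgeI) simp_all
      then show ?thesis using True xy(5) by (simp add: diagonal_def)
    next
      case False
      then have "of_kind i (x + 1, y)" "of_kind i (x, y + 1)"
        using of_kind_neighbour[OF assms] by simp_all
      then have "{(x + 1, y), (x, y + 1)} \<in> hammock_edges i l w"
        using corners by (intro edgeI) simp_all
      then show ?thesis using False xy(5) by (simp add: diagonal_def)
    qed
  qed
next
  show "hammock_edges i l w \<subseteq> diagonal i ` cells l w"
  proof
    fix e assume "e \<in> hammock_edges i l w"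
    then obtain a b c d where e: "e = {(a, b), (c, d)}"
      and pts: "0 \<le> a" "a \<le> int l" "0 \<le> b" "b \<le> int w" "0 \<le> c" "c \<le> int l" "0 \<le> d" "d \<le> int w"
      and adj: "\<bar>a - c\<bar> = 1" "\<bar>b - d\<bar> = 1" and kind: "of_kind i (a, b)" "of_kind i (c, d)"
      by (auto simp: hammock_edges_def lattice_edges_def lattice_points_def)
    have "(c = a + 1 \<or> a = c + 1) \<and> (d = b + 1 \<or> b = d + 1)" using adj by arith
    then have "e = diagonal i (min a c, min b d)"
      using e kind of_kind_neighbour[OF assms] by (auto simp: diagonal_def)
    moreover have "(min a c, min b d) \<in> cells l w"
      using pts adj by (auto simp: cells_def)
    ultimately show "e \<in> diagonal i ` cells l w" by blast
  qed
qed

section \<open>Reachability\<close>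

definition reachable :: "nat \<Rightarrow> nat \<Rightarrow> nat \<Rightarrow> point set set \<Rightarrow> point \<Rightarrow> bool" where
  "reachable i l w P v \<longleftrightarrow>
     (\<exists>vs. X_path vs \<and> hd vs \<in> source_nodes i l w \<and> last vs = v \<and> path_segments vs \<subseteq> P)"

lemma pathsets_iff_reachable:
  "P \<in> pathsets i l w \<longleftrightarrow>
     P \<subseteq> hammock_edges i l w \<and> (\<exists>v\<in>terminus_nodes i l w. reachable i l w P v)"
  by (auto simp: pathsets_def reachable_def)

lemma source_reachable: "v \<in> source_nodes i l w \<Longrightarrow> reachable i l w P v"
  unfolding reachable_def by (rule exI[of _ "[v]"]) (auto simp: X_path_def path_segments_def)

lemma X_path_snoc:
  assumes "X_path vs" "v \<notin> set vs" "v - last vs \<in> {(1, 1), (-1, 1), (1, -1), (-1, -1)}"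
  shows "X_path (vs @ [v])"
proof -
  have "(vs @ [v]) ! Suc j - (vs @ [v]) ! j \<in> {(1, 1), (-1, 1), (1, -1), (-1, -1)}"
    if "Suc j < length (vs @ [v])" for j
  proof (cases "Suc j < length vs")
    case True
    then show ?thesis using assms(1) by (simp add: X_path_def nth_append)
  next
    case False
    then have j: "j = length vs - 1" "vs \<noteq> []" using that assms(1) by (auto simp: X_path_def)
    then show ?thesis using assms(3) by (simp add: nth_append last_conv_nth)
  qed
  then show ?thesis using assms(1,2) by (simp add: X_path_def)
qed

lemma path_segments_snoc:
  assumes "vs \<noteq> []"
  shows "path_segments (vs @ [v]) \<subseteq> insert {last vs, v} (path_segments vs)"
proof
  fix e assume "e \<in> path_segments (vs @ [v])"
  then obtain j where j: "Suc j < length (vs @ [v])" "e = {(vs @ [v]) ! j, (vs @ [v]) ! Suc j}"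
    by (auto simp: path_segments_def)
  show "e \<in> insert {last vs, v} (path_segments vs)"
  proof (cases "Suc j < length vs")
    case True
    then show ?thesis using j by (auto simp: path_segments_def nth_append)
  next
    case False
    then have "j = length vs - 1" using j by auto
    then show ?thesis using j assms by (simp add: nth_append last_conv_nth)
  qed
qed

lemma X_path_prefix:
  assumes "X_path (xs @ v # ys)"
  shows "X_path (xs @ [v])"
  unfolding X_path_def
proof (intro conjI allI impI)
  show "xs @ [v] \<noteq> []" "distinct (xs @ [v])" using assms by (auto simp: X_path_def)
  fix j assume j: "Suc j < length (xs @ [v])"
  have "(xs @ [v]) ! k = (xs @ v # ys) ! k" if "k < length (xs @ [v])" for k
    using that by (auto simp: nth_append nth_Cons split: nat.splits)
  then show "(xs @ [v]) ! Suc j - (xs @ [v]) ! j \<in> {(1, 1), (-1, 1), (1, -1), (-1, -1)}"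
    using assms j by (simp add: X_path_def del: insert_iff)
qed

lemma path_segments_prefix: "path_segments (xs @ [v]) \<subseteq> path_segments (xs @ v # ys)"
proof
  fix e assume "e \<in> path_segments (xs @ [v])"
  then obtain j where j: "Suc j < length (xs @ [v])" "e = {(xs @ [v]) ! j, (xs @ [v]) ! Suc j}"
    by (auto simp: path_segments_def)
  have "(xs @ [v]) ! k = (xs @ v # ys) ! k" if "k < length (xs @ [v])" for k
    using that by (auto simp: nth_append nth_Cons split: nat.splits)
  then show "e \<in> path_segments (xs @ v # ys)" using j unfolding path_segments_def
    by (intro CollectI exI[of _ j]) simp
qed

text \<open>
  Appending \<open>v\<close> to a path could repeat a point. In that case the path already passes through
  \<open>v\<close>, and its initial part up to \<open>v\<close> is the required path.
\<close>

lemma reachable_step: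
  assumes "reachable i l w P u" "{u, v} \<in> P" "P \<subseteq> hammock_edges i l w"
  shows "reachable i l w P v"
proof -
  obtain vs where vs: "X_path vs" "hd vs \<in> source_nodes i l w" "last vs = u" "path_segments vs \<subseteq> P"
    using assms(1) by (auto simp: reachable_def)
  have ne: "vs \<noteq> []" using vs(1) by (simp add: X_path_def)
  show ?thesis
  proof (cases "v \<in> set vs")
    case True
    then obtain xs ys where split: "vs = xs @ v # ys" by (meson split_list)
    have "hd (xs @ [v]) = hd vs" using split by (cases xs) auto
    then show ?thesis unfolding reachable_def
      using vs X_path_prefix[of xs v ys] path_segments_prefix[of xs v ys] split
      by (intro exI[of _ "xs @ [v]"]) auto
  next
    case False
    have "\<bar>fst u - fst v\<bar> = 1 \<and> \<bar>snd u - snd v\<bar> = 1"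
      using assms(2,3) by (force simp: hammock_edges_def lattice_edges_def doubleton_eq_iff)
    then have "v - u \<in> {(1, 1), (-1, 1), (1, -1), (-1, -1)}"
      by (cases u; cases v) (auto simp: abs_if split: if_splits)
    then have "X_path (vs @ [v])" using X_path_snoc vs False by blast
    moreover have "path_segments (vs @ [v]) \<subseteq> P"
      using path_segments_snoc[OF ne, of v] vs assms(2) by auto
    ultimately show ?thesis unfolding reachable_def
      using vs ne by (intro exI[of _ "vs @ [v]"]) auto
  qed
qed

lemma reachable_edge_iff:
  assumes "{u, v} \<in> P" "P \<subseteq> hammock_edges i l w"
  shows "reachable i l w P u \<longleftrightarrow> reachable i l w P v"
  using reachable_step assms by (metis insert_commute)

section \<open>Existence of a crossing\<close>

lemma alternating_sum_telescope:
  fixes g :: "nat \<Rightarrow> int"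
  shows "(\<Sum>k<n. (-1) ^ k * (g k + g (Suc k))) = g 0 - (-1) ^ n * g n"
  by (induction n) (auto simp: algebra_simps)

text \<open>
  A discrete Stokes formula. For a cell with corners \<open>a, b, c, d\<close> in cyclic order,
  \<open>(F c - F a) * (F d - F b) = F c * F d + F a * F b - F b * F c - F a * F d\<close>
  is a sum over the four sides of the cell, the horizontal sides counted positively and the vertical
  ones negatively. The checkerboard sign is opposite in adjacent cells, so every side shared
  by two cells cancels.
\<close>

lemma checkerboard_sum:
  fixes F :: "nat \<Rightarrow> nat \<Rightarrow> int"
  shows "(\<Sum>x<l. \<Sum>y<w. (-1) ^ (x + y) *
            ((F (Suc x) (Suc y) - F x y) * (F x (Suc y) - F (Suc x) y))) =
         (\<Sum>x<l. (-1) ^ x * (F x 0 * F (Suc x) 0 - (-1) ^ w * (F x w * F (Suc x) w))) -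
         (\<Sum>y<w. (-1) ^ y * (F 0 y * F 0 (Suc y) - (-1) ^ l * (F l y * F l (Suc y))))"
proof -
  let ?h = "\<lambda>x y. F x y * F (Suc x) y" and ?v = "\<lambda>x y. F x y * F x (Suc y)"
  have "(\<Sum>x<l. \<Sum>y<w. (-1) ^ (x + y) *
            ((F (Suc x) (Suc y) - F x y) * (F x (Suc y) - F (Suc x) y))) =
        (\<Sum>x<l. (-1) ^ x * (\<Sum>y<w. (-1) ^ y * (?h x y + ?h x (Suc y)))) -
        (\<Sum>x<l. \<Sum>y<w. (-1) ^ y * ((-1) ^ x * (?v x y + ?v (Suc x) y)))"
    by (simp add: sum_distrib_left sum_subtractf[symmetric] power_add algebra_simps)
  also have "(\<Sum>x<l. \<Sum>y<w. (-1) ^ y * ((-1) ^ x * (?v x y + ?v (Suc x) y))) =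
             (\<Sum>y<w. (-1) ^ y * (\<Sum>x<l. (-1) ^ x * (?v x y + ?v (Suc x) y)))"
    by (subst sum.swap) (simp add: sum_distrib_left)
  also have "(\<lambda>x. \<Sum>y<w. (-1) ^ y * (?h x y + ?h x (Suc y))) = (\<lambda>x. ?h x 0 - (-1) ^ w * ?h x w)"
    by (rule ext) (rule alternating_sum_telescope)
  also have "(\<lambda>y. \<Sum>x<l. (-1) ^ x * (?v x y + ?v (Suc x) y)) = (\<lambda>y. ?v 0 y - (-1) ^ l * ?v l y)"
    by (rule ext) (rule alternating_sum_telescope[of "\<lambda>x. ?v x _"])
  finally show ?thesis .
qed

text \<open>
  A relative of Sperner's lemma. The sides of the rectangle on which \<open>F\<close> vanishes on one kind of
  points contribute nothing to the boundary terms of the formula above, since every unit segment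
  has an endpoint of each kind. On the other two sides the factor 1 leaves only the values of \<open>F\<close> at
  points of the opposite kind; these telescope as well, down to the corner \<open>(0, 0)\<close>. It contributes
  1 through the bottom side if \<open>K 0 0\<close> holds, and -1 through the left side otherwise. Hence the
  sum over the cells is not 0.
\<close>

lemma bichromatic_cell:
  fixes F :: "nat \<Rightarrow> nat \<Rightarrow> int"
  assumes K: "\<And>x y. K (Suc x) y \<longleftrightarrow> \<not> K x y" "\<And>x y. K x (Suc y) \<longleftrightarrow> \<not> K x y"
    and left: "\<And>y. y \<le> w \<Longrightarrow> K 0 y \<Longrightarrow> F 0 y = 1"
    and right: "\<And>y. y \<le> w \<Longrightarrow> K l y \<Longrightarrow> F l y = 0"
    and bottom: "\<And>x. x \<le> l \<Longrightarrow> \<not> K x 0 \<Longrightarrow> F x 0 = 1"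
    and top: "\<And>x. x \<le> l \<Longrightarrow> \<not> K x w \<Longrightarrow> F x w = 0"
  shows "\<exists>x<l. \<exists>y<w. F (Suc x) (Suc y) \<noteq> F x y \<and> F x (Suc y) \<noteq> F (Suc x) y"
proof (rule ccontr)
  assume "\<not> ?thesis"
  then have "(\<Sum>x<l. \<Sum>y<w. (-1) ^ (x + y) *
            ((F (Suc x) (Suc y) - F x y) * (F x (Suc y) - F (Suc x) y))) = 0"
    by (intro sum.neutral ballI) auto
  moreover have "(\<Sum>x<l. (-1) ^ x * (F x 0 * F (Suc x) 0 - (-1) ^ w * (F x w * F (Suc x) w)))
               = of_bool (K 0 0)"
  proof -
    define g where "g x = (if K x 0 then F x 0 else 0)" for x
    have "F x 0 * F (Suc x) 0 - (-1) ^ w * (F x w * F (Suc x) w) = g x + g (Suc x)" if "x < l" for x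
      using that bottom[of x] bottom[of "Suc x"] top[of x] top[of "Suc x"] K(1)
      by (cases "K x 0"; cases "K x w") (auto simp: g_def)
    then have "(\<Sum>x<l. (-1) ^ x * (F x 0 * F (Suc x) 0 - (-1) ^ w * (F x w * F (Suc x) w)))
       = (\<Sum>x<l. (-1) ^ x * (g x + g (Suc x)))" by (intro sum.cong) auto
    also have "\<dots> = g 0 - (-1) ^ l * g l" by (rule alternating_sum_telescope)
    also have "\<dots> = of_bool (K 0 0)" using left[of 0] right[of 0] by (simp add: g_def)
    finally show ?thesis .
  qed
  moreover have "(\<Sum>y<w. (-1) ^ y * (F 0 y * F 0 (Suc y) - (-1) ^ l * (F l y * F l (Suc y))))
               = of_bool (\<not> K 0 0)"
  proof -
    define g where "g y = (if K 0 y then 0 else F 0 y)" for y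
    have "F 0 y * F 0 (Suc y) - (-1) ^ l * (F l y * F l (Suc y)) = g y + g (Suc y)" if "y < w" for y
      using that left[of y] left[of "Suc y"] right[of y] right[of "Suc y"] K(2)
      by (cases "K 0 y"; cases "K l y") (auto simp: g_def)
    then have "(\<Sum>y<w. (-1) ^ y * (F 0 y * F 0 (Suc y) - (-1) ^ l * (F l y * F l (Suc y))))
       = (\<Sum>y<w. (-1) ^ y * (g y + g (Suc y)))" by (intro sum.cong) auto
    also have "\<dots> = g 0 - (-1) ^ w * g w" by (rule alternating_sum_telescope)
    also have "\<dots> = of_bool (\<not> K 0 0)" using bottom[of 0] top[of 0] by (simp add: g_def)
    finally show ?thesis .
  qed
  ultimately show False using checkerboard_sum[of F w l] by (cases "K 0 0") simp_all
qed

lemma some_crossing: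
  assumes i: "i \<in> {1, 2}" and S: "S \<subseteq> cells l w"
  shows "diagonal i ` S \<in> pathsets i l w \<or>
         diagonal (2 div i) ` prod.swap ` (cells l w - S) \<in> pathsets (2 div i) w l"
proof (rule ccontr)
  assume "\<not> ?thesis"
  then have no: "diagonal i ` S \<notin> pathsets i l w"
    and no': "diagonal (2 div i) ` prod.swap ` (cells l w - S) \<notin> pathsets (2 div i) w l"
    by blast+
  define j where "j = 2 div i"
  have j: "j \<in> {1, 2}" using i by (auto simp: j_def)
  have kind_j: "of_kind j v \<longleftrightarrow> \<not> of_kind i v" for v using other_kind[OF i] by (simp add: j_def)
  define P where "P = diagonal i ` S"
  define Q where "Q = diagonal j ` prod.swap ` (cells l w - S)"
  have P: "P \<subseteq> hammock_edges i l w"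
    using S hammock_edges_eq_diagonals[OF i] by (auto simp: P_def)
  have "prod.swap ` (cells l w - S) \<subseteq> cells w l" using swap_cells by blast
  then have Q: "Q \<subseteq> hammock_edges j w l"
    using hammock_edges_eq_diagonals[OF j] by (auto simp: Q_def)
  define F :: "nat \<Rightarrow> nat \<Rightarrow> int" where
    "F x y = of_bool (if of_kind i (int x, int y) then reachable i l w P (int x, int y)
                      else reachable j w l Q (int y, int x))" for x y
  have "\<exists>x<l. \<exists>y<w. F (Suc x) (Suc y) \<noteq> F x y \<and> F x (Suc y) \<noteq> F (Suc x) y"
  proof (rule bichromatic_cell[where K = "\<lambda>x y. of_kind i (int x, int y)"])
    show "of_kind i (int (Suc x), int y) \<longleftrightarrow> \<not> of_kind i (int x, int y)" for x y
      using of_kind_neighbour(1)[OF i, of "int x" "int y"] by (simp add: add.commute)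
    show "of_kind i (int x, int (Suc y)) \<longleftrightarrow> \<not> of_kind i (int x, int y)" for x y
      using of_kind_neighbour(2)[OF i, of "int x" "int y"] by (simp add: add.commute)
    show "F 0 y = 1" if "y \<le> w" "of_kind i (int 0, int y)" for y
      using that source_reachable[of "(0, int y)" i l w P]
      by (simp add: F_def source_nodes_def hammock_nodes_def lattice_points_def)
    show "F x 0 = 1" if "x \<le> l" "\<not> of_kind i (int x, int 0)" for x
      using that source_reachable[of "(0, int x)" j w l Q] kind_j of_kind_swap[of i 0 "int x"]
      by (simp add: F_def source_nodes_def hammock_nodes_def lattice_points_def)
    show "F l y = 0" if "y \<le> w" "of_kind i (int l, int y)" for y
      using that no P pathsets_iff_reachable[of P i l w]
      by (auto simp: F_def P_def terminus_nodes_def hammock_nodes_def lattice_points_def)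
    show "F x w = 0" if "x \<le> l" "\<not> of_kind i (int x, int w)" for x
      using that no' Q pathsets_iff_reachable[of Q j w l] kind_j of_kind_swap[of i "int w" "int x"]
      by (auto simp: F_def Q_def j_def terminus_nodes_def hammock_nodes_def lattice_points_def)
  qed
  then obtain x y where xy: "x < l" "y < w" "F (Suc x) (Suc y) \<noteq> F x y" "F x (Suc y) \<noteq> F (Suc x) y"
    by blast
  define X Y where "X = int x" and "Y = int y"
  have c: "(X, Y) \<in> cells l w" using xy by (simp add: cells_def X_def Y_def)
  have kinds: "of_kind i (X + 1, Y) \<longleftrightarrow> \<not> of_kind i (X, Y)"
      "of_kind i (X, Y + 1) \<longleftrightarrow> \<not> of_kind i (X, Y)"
      "of_kind i (X + 1, Y + 1) \<longleftrightarrow> of_kind i (X, Y)"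
      "of_kind i (Y, X) \<longleftrightarrow> of_kind i (X, Y)"
    using of_kind_neighbour[OF i] of_kind_swap by simp_all
  have F: "F x y = of_bool (if of_kind i (X, Y) then reachable i l w P (X, Y) else reachable j w l Q (Y, X))"
    "F (Suc x) (Suc y) = of_bool (if of_kind i (X, Y) then reachable i l w P (X + 1, Y + 1)
        else reachable j w l Q (Y + 1, X + 1))"
    "F (Suc x) y = of_bool (if of_kind i (X, Y) then reachable j w l Q (Y, X + 1)
        else reachable i l w P (X + 1, Y))"
    "F x (Suc y) = of_bool (if of_kind i (X, Y) then reachable j w l Q (Y + 1, X)
        else reachable i l w P (X, Y + 1))"
    using kinds by (auto simp: F_def X_def Y_def add.commute)
  show False
  proof (cases "(X, Y) \<in> S")
    case True
    then have "diagonal i (X, Y) \<in> P" by (simp add: P_def)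
    then show False using xy(3,4) F reachable_edge_iff[OF _ P]
      by (auto simp: diagonal_def split: if_splits)
  next
    case False
    then have "prod.swap (X, Y) \<in> prod.swap ` (cells l w - S)" using c by blast
    then have "diagonal j (Y, X) \<in> Q" unfolding Q_def by simp
    then show False using xy(3,4) F reachable_edge_iff[OF _ Q] kinds kind_j
      by (auto simp: diagonal_def split: if_splits)
  qed
qed

section \<open>Exclusiveness of the crossings\<close>

text \<open>
  The path \<open>vs\<close> lives in the reflected network: \<open>fst\<close> is its height and \<open>snd\<close> its horizontal
  position. Each of its steps that passes through the strip between the heights \<open>t\<close> and \<open>t + 1\<close>
  in a cell to the left of the abscissa \<open>x\<close> counts \<open>+1\<close> upwards and \<open>-1\<close> downwards.
\<close>

definition strip_crossings :: "point list \<Rightarrow> int \<Rightarrow> int \<Rightarrow> int" where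
  "strip_crossings vs t x = (\<Sum>k<length vs - 1.
     if min (snd (vs ! k)) (snd (vs ! Suc k)) < x
     then of_bool (t < fst (vs ! Suc k)) - of_bool (t < fst (vs ! k)) else 0)"

text \<open>
  Whatever enters row \<open>t\<close> to the left of \<open>(x, t)\<close> must leave it there as well, since the path neither
  starts nor ends in this row. A step of the path with an endpoint in row \<open>t\<close> cannot straddle \<open>x\<close>:
  it moves horizontally by 1, and parity keeps that endpoint away from \<open>(x, t)\<close>.
\<close>

lemma strip_crossings_next_strip:
  assumes kind: "of_kind i (x, t)"
    and step: "\<And>k. Suc k < length vs \<Longrightarrow>
      \<not> of_kind i (vs ! k) \<and> \<not> of_kind i (vs ! Suc k) \<and> \<bar>snd (vs ! k) - snd (vs ! Suc k)\<bar> = 1"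
    and ends: "fst (vs ! 0) \<noteq> t" "fst (vs ! (length vs - 1)) \<noteq> t"
  shows "strip_crossings vs t x = strip_crossings vs (t - 1) x"
proof -
  define g :: "nat \<Rightarrow> int" where "g k = of_bool (fst (vs ! k) = t \<and> snd (vs ! k) < x)" for k
  have "strip_crossings vs t x - strip_crossings vs (t - 1) x = (\<Sum>k<length vs - 1. g k - g (Suc k))"
    unfolding strip_crossings_def sum_subtractf[symmetric]
  proof (intro sum.cong refl)
    fix k assume "k \<in> {..<length vs - 1}"
    then have st: "\<not> of_kind i (vs ! k)" "\<not> of_kind i (vs ! Suc k)"
       "\<bar>snd (vs ! k) - snd (vs ! Suc k)\<bar> = 1" using step[of k] by auto
    have off: "fst v = t \<Longrightarrow> snd v \<noteq> x" if "\<not> of_kind i v" for v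
      using that kind of_kind_swap[of i x t] by (cases v) auto
    show "(if min (snd (vs ! k)) (snd (vs ! Suc k)) < x
           then of_bool (t < fst (vs ! Suc k)) - of_bool (t < fst (vs ! k)) else 0) -
          (if min (snd (vs ! k)) (snd (vs ! Suc k)) < x
           then of_bool (t - 1 < fst (vs ! Suc k)) - of_bool (t - 1 < fst (vs ! k)) else 0)
          = g k - g (Suc k)"
      using st(3) off[OF st(1)] off[OF st(2)] unfolding g_def of_bool_def
      by (smt (verit))
  qed
  also have "\<dots> = g 0 - g (length vs - 1)"
    by (rule sum_lessThan_telescope')
  also have "\<dots> = 0" using ends by (simp add: g_def)
  finally show ?thesis by simp
qed

lemma crossings_exclusive:
  assumes i: "i \<in> {1, 2}" and S: "S \<subseteq> cells l w" and w: "w \<ge> 1"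
  shows "\<not> (diagonal i ` S \<in> pathsets i l w \<and>
            diagonal (2 div i) ` prod.swap ` (cells l w - S) \<in> pathsets (2 div i) w l)"
proof
  assume "diagonal i ` S \<in> pathsets i l w \<and>
          diagonal (2 div i) ` prod.swap ` (cells l w - S) \<in> pathsets (2 div i) w l"
  then have yes: "diagonal i ` S \<in> pathsets i l w"
    and yes': "diagonal (2 div i) ` prod.swap ` (cells l w - S) \<in> pathsets (2 div i) w l"
    by blast+
  define j where "j = 2 div i"
  have kind_j: "of_kind j v \<longleftrightarrow> \<not> of_kind i v" for v using other_kind[OF i] by (simp add: j_def)
  obtain us where us: "us \<noteq> []" "hd us \<in> source_nodes i l w" "last us \<in> terminus_nodes i l w"
     "path_segments us \<subseteq> diagonal i ` S"
    using yes by (auto simp: pathsets_def X_path_def)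
  obtain vs where vs: "vs \<noteq> []" "hd vs \<in> source_nodes j w l" "last vs \<in> terminus_nodes j w l"
     "path_segments vs \<subseteq> diagonal j ` prod.swap ` (cells l w - S)"
    using yes' by (auto simp: pathsets_def X_path_def j_def)
  have sub': "diagonal j ` prod.swap ` (cells l w - S) \<subseteq> hammock_edges j w l"
    using yes' by (auto simp: pathsets_def j_def)
  have sub: "diagonal i ` S \<subseteq> hammock_edges i l w"
    using yes by (auto simp: pathsets_def)
  have v_step: "\<exists>a b. (a, b) \<in> cells l w - S \<and> \<bar>fst (vs ! k) - fst (vs ! Suc k)\<bar> = 1
       \<and> \<bar>snd (vs ! k) - snd (vs ! Suc k)\<bar> = 1
       \<and> min (fst (vs ! k)) (fst (vs ! Suc k)) = b \<and> min (snd (vs ! k)) (snd (vs ! Suc k)) = a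
       \<and> \<not> of_kind i (vs ! k) \<and> \<not> of_kind i (vs ! Suc k)"
    if "Suc k < length vs" for k
  proof -
    have "{vs ! k, vs ! Suc k} \<in> path_segments vs" using that by (auto simp: path_segments_def)
    then have mem: "{vs ! k, vs ! Suc k} \<in> diagonal j ` prod.swap ` (cells l w - S)" using vs by blast
    then have "{vs ! k, vs ! Suc k} \<in> hammock_edges j w l" using sub' by blast
    then have kinds: "\<not> of_kind i (vs ! k)" "\<not> of_kind i (vs ! Suc k)"
      using kind_j by (auto simp: hammock_edges_def)
    obtain a b where ab: "(a, b) \<in> cells l w - S" "{vs ! k, vs ! Suc k} = diagonal j (b, a)"
      using mem by auto
    show ?thesis using ab(1) kinds by (rule_tac diagonal_cases[OF ab(2)]) blast
  qed
  \<comment> \<open>The potential of \<open>u\<close> looks at the strip above \<open>u\<close>; on the top side, where there is none, at the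
    strip below.\<close>
  define f where "f u = strip_crossings vs (if snd u < int w then snd u else int w - 1) (fst u)" for u
  have v0: "fst (vs ! 0) = 0" and vn: "fst (vs ! (length vs - 1)) = int w"
    using vs by (auto simp: source_nodes_def terminus_nodes_def hd_conv_nth last_conv_nth)
  \<comment> \<open>Both endpoints of a diagonal can be assigned the strip that contains it. Between them the
    abscissa changes by 1, which matters only for a step of \<open>vs\<close> in the very cell of the diagonal.\<close>
  have f_edge: "f (x', y + 1) = f (x, y)"
    if cell: "(min x x', y) \<in> S" and adj: "\<bar>x - x'\<bar> = 1" and kind: "of_kind i (x', y + 1)" for x x' y
  proof -
    have y: "0 \<le> y" "y < int w" using cell S by (auto simp: cells_def)
    have "f (x', y + 1) = strip_crossings vs y x'"
    proof (cases "y + 1 < int w")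
      case True
      then have "f (x', y + 1) = strip_crossings vs (y + 1) x'" by (simp add: f_def)
      also have "\<dots> = strip_crossings vs (y + 1 - 1) x'"
        using strip_crossings_next_strip[OF kind, of vs] v_step v0 vn y True by fastforce
      finally show ?thesis by simp
    next
      case False
      then have "y = int w - 1" using y by simp
      then show ?thesis by (simp add: f_def)
    qed
    also have "\<dots> = strip_crossings vs y x"
      unfolding strip_crossings_def
    proof (intro sum.cong refl)
      fix k assume "k \<in> {..<length vs - 1}"
      then have "Suc k < length vs" by simp
      from v_step[OF this] obtain a b where ab: "(a, b) \<notin> S" "\<bar>fst (vs ! k) - fst (vs ! Suc k)\<bar> = 1"
        "min (fst (vs ! k)) (fst (vs ! Suc k)) = b" "min (snd (vs ! k)) (snd (vs ! Suc k)) = a"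
        by blast
      have "a \<noteq> min x x' \<or> b \<noteq> y" using ab(1) cell by auto
      then show "(if min (snd (vs ! k)) (snd (vs ! Suc k)) < x'
           then of_bool (y < fst (vs ! Suc k)) - of_bool (y < fst (vs ! k)) else 0) =
          (if min (snd (vs ! k)) (snd (vs ! Suc k)) < x
           then of_bool (y < fst (vs ! Suc k)) - of_bool (y < fst (vs ! k)) else (0::int))"
        using adj ab(2,3) unfolding ab(4) of_bool_def by (smt (verit))
    qed
    also have "\<dots> = f (x, y)" using y by (simp add: f_def)
    finally show ?thesis .
  qed
  have u_step: "f (us ! Suc k) = f (us ! k)" if "Suc k < length us" for k
  proof -
    have "{us ! k, us ! Suc k} \<in> path_segments us" using that by (auto simp: path_segments_def)
    then have mem: "{us ! k, us ! Suc k} \<in> diagonal i ` S" using us by blast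
    then have "{us ! k, us ! Suc k} \<in> hammock_edges i l w" using sub by blast
    then have kinds: "of_kind i (us ! k)" "of_kind i (us ! Suc k)"
      by (auto simp: hammock_edges_def)
    obtain a b where ab: "(a, b) \<in> S" "{us ! k, us ! Suc k} = diagonal i (a, b)"
      using mem by auto
    obtain p q p' q' where pq: "us ! k = (p, q)" "us ! Suc k = (p', q')" by (metis surj_pair)
    have *: "\<bar>p - p'\<bar> = 1" "\<bar>q - q'\<bar> = 1" "min p p' = a" "min q q' = b"
      using diagonal_cases[OF ab(2)] pq by auto
    then consider "q' = q + 1" "b = q" | "q = q' + 1" "b = q'" by linarith
    then show ?thesis
    proof cases
      case 1
      then show ?thesis using f_edge[of p p' q] * ab kinds pq by simp
    next
      case 2
      then show ?thesis using f_edge[of p' p q'] * ab kinds pq by (simp add: min.commute)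
    qed
  qed
  have const: "f (us ! k) = f (us ! 0)" if "k < length us" for k
    using that by (induction k) (use u_step in auto)
  have "f (last us) = f (hd us)"
    using const[of "length us - 1"] us(1) by (simp add: last_conv_nth hd_conv_nth)
  moreover have "f (hd us) = 0"
  proof -
    have "fst (hd us) = 0" using us by (simp add: source_nodes_def)
    moreover have "min (snd (vs ! k)) (snd (vs ! Suc k)) \<ge> 0" if "k < length vs - 1" for k
      using v_step[of k] that by (auto simp: cells_def)
    ultimately show ?thesis unfolding f_def strip_crossings_def
      by (intro sum.neutral) (auto simp: not_less[symmetric])
  qed
  moreover have "f (last us) = 1"
  proof -
    define t where "t = (if snd (last us) < int w then snd (last us) else int w - 1)"
    have t: "0 \<le> t" "t < int w" and x: "fst (last us) = int l"
      using us(3) w by (auto simp: t_def terminus_nodes_def hammock_nodes_def lattice_points_def)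
    have "min (snd (vs ! k)) (snd (vs ! Suc k)) < int l" if "k < length vs - 1" for k
      using v_step[of k] that by (auto simp: cells_def)
    then have "strip_crossings vs t (int l) =
        (\<Sum>k<length vs - 1. of_bool (t < fst (vs ! Suc k)) - of_bool (t < fst (vs ! k)))"
      unfolding strip_crossings_def by (intro sum.cong) auto
    also have "\<dots> = of_bool (t < fst (vs ! (length vs - 1))) - of_bool (t < fst (vs ! 0))"
      by (rule sum_lessThan_telescope)
    also have "\<dots> = 1" using t v0 vn by simp
    finally show ?thesis using x by (simp add: f_def t_def)
  qed
  ultimately show False by simp
qed

section \<open>Summation over states\<close>

lemma reliability_sum_cells:
  assumes "i \<in> {1, 2}"
  shows "reliability i l w p =
    (\<Sum>S | S \<subseteq> cells l w \<and> diagonal i ` S \<in> pathsets i l w. p ^ card S * (1 - p) ^ (l * w - card S))"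
proof -
  let ?A = "{S. S \<subseteq> cells l w \<and> diagonal i ` S \<in> pathsets i l w}"
  have "P \<in> (`) (diagonal i) ` ?A" if P: "P \<in> pathsets i l w" for P
  proof -
    have "P \<subseteq> diagonal i ` cells l w"
      using P hammock_edges_eq_diagonals[OF assms] by (auto simp: pathsets_def)
    then obtain S where "S \<subseteq> cells l w" "P = diagonal i ` S" by (meson subset_imageE)
    then show ?thesis using P by blast
  qed
  then have image: "pathsets i l w = (`) (diagonal i) ` ?A" by blast
  have inj: "inj_on ((`) (diagonal i)) ?A"
    using inj_diagonal by (intro inj_onI) (simp add: inj_image_eq_iff)
  have "reliability i l w p =
      (\<Sum>S\<in>?A. p ^ card (diagonal i ` S) * (1 - p) ^ (l * w - card (diagonal i ` S)))"
    unfolding reliability_def by (subst image, subst sum.reindex[OF inj]) simp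
  then show ?thesis by (simp add: card_image inj_on_subset[OF inj_diagonal])
qed

lemma sum_states_eq_one:
  fixes p :: real
  assumes "finite A"
  shows "(\<Sum>S\<in>Pow A. p ^ card S * (1 - p) ^ (card A - card S)) = 1"
proof -
  have "(\<Sum>S\<in>Pow A. p ^ card S * (1 - p) ^ (card A - card S)) =
        (\<Sum>S\<in>Pow A. (\<Prod>a\<in>S. p) * (\<Prod>a\<in>A - S. 1 - p))"
    using assms by (intro sum.cong) (auto simp: card_Diff_subset finite_subset)
  also have "\<dots> = (\<Prod>a\<in>A. p + (1 - p))" using assms by (rule prod_add[symmetric])
  finally show ?thesis by simp
qed

theorem corollary2:
  fixes l w i :: nat and p :: real
  assumes "l \<ge> 1" and "w \<ge> 1" and "i \<in> {1, 2}" and "0 \<le> p" and "p \<le> 1"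
  shows "reliability i l w p = 1 - reliability (2 div i) w l (1 - p)"
proof -
  let ?weight = "\<lambda>S. p ^ card S * (1 - p) ^ (l * w - card S)"
  let ?conn = "\<lambda>S. diagonal i ` S \<in> pathsets i l w"
  let ?dual = "\<lambda>S. prod.swap ` (cells l w - S)"
  have j: "2 div i \<in> {1, 2}" using assms(3) by auto
  have dual_conn: "diagonal (2 div i) ` ?dual S \<in> pathsets (2 div i) w l \<longleftrightarrow> \<not> ?conn S"
    if "S \<subseteq> cells l w" for S
    using some_crossing[OF assms(3) that] crossings_exclusive[OF assms(3) that assms(2)] by blast
  have "reliability (2 div i) w l (1 - p) =
      (\<Sum>T | T \<subseteq> cells w l \<and> diagonal (2 div i) ` T \<in> pathsets (2 div i) w l.
         (1 - p) ^ card T * p ^ (w * l - card T))"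
    using reliability_sum_cells[OF j, of w l "1 - p"] by simp
  also have "\<dots> = (\<Sum>S | S \<subseteq> cells l w \<and> \<not> ?conn S. ?weight S)"
  proof (rule sum.reindex_bij_witness[where i = ?dual and j = "\<lambda>T. cells l w - prod.swap ` T"])
    fix T assume T: "T \<in> {T. T \<subseteq> cells w l \<and> diagonal (2 div i) ` T \<in> pathsets (2 div i) w l}"
    have sub: "prod.swap ` T \<subseteq> cells l w" using T swap_cells[of w l] by blast
    then show dual: "?dual (cells l w - prod.swap ` T) = T" by (simp add: double_diff image_image)
    show "cells l w - prod.swap ` T \<in> {S. S \<subseteq> cells l w \<and> \<not> ?conn S}"
      using dual_conn[of "cells l w - prod.swap ` T"] dual T by auto
    have "card (prod.swap ` T) = card T" by (simp add: card_image)
    moreover have "card T \<le> l * w"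
      using T card_mono[of "cells w l" T] by (simp add: card_cells mult.commute)
    ultimately show "?weight (cells l w - prod.swap ` T) = (1 - p) ^ card T * p ^ (w * l - card T)"
      using sub by (simp add: card_Diff_subset finite_subset[OF sub] card_cells mult.commute)
  next
    fix S assume S: "S \<in> {S. S \<subseteq> cells l w \<and> \<not> ?conn S}"
    then show "cells l w - prod.swap ` ?dual S = S" by (auto simp: image_image)
    show "?dual S \<in> {T. T \<subseteq> cells w l \<and> diagonal (2 div i) ` T \<in> pathsets (2 div i) w l}"
      using S dual_conn[of S] swap_cells[of l w] by blast
  qed
  finally have "reliability i l w p + reliability (2 div i) w l (1 - p) =
      (\<Sum>S | S \<subseteq> cells l w \<and> ?conn S. ?weight S) + (\<Sum>S | S \<subseteq> cells l w \<and> \<not> ?conn S. ?weight S)"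
    using reliability_sum_cells[OF assms(3), of l w p] by simp
  also have "\<dots> = (\<Sum>S\<in>Pow (cells l w). ?weight S)"
    by (subst sum.union_disjoint[symmetric]) (auto intro!: sum.cong)
  also have "\<dots> = 1" using sum_states_eq_one[of "cells l w" p] by (simp add: card_cells)
  finally show ?thesis by simp
qed

end
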